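(* The PageRank protocol (written out in the context) takes $$\mathcal{O}\left((n^2+lm)\,f(n^2)\right)$$ primitive operations for computing the PageRank centrality.
   Context: **Graphs and representation.** $G(V,E)$ is a directed graph with vertex set $V=\{1,\dots,n\}$ and $m=|E|$ edges, given in the edgelist representation $(\mathcal{E},Idx)$. $\mathcal{E}$ is an array of length $m+1$ containing the concatenated adjacency lists (out-neighbours) of all vertices (in the order $1,2,\dots,n$) and an empty element at the end. $Idx$ is an array of length $n$: $Idx[u]=i$ if out-degree$(u)\neq 0$ and $\mathcal{E}[i]$ is the first neighbour of $u$ in $\mathcal{E}$; $Idx[u]=Idx[u+1]$ if $u\neq n$ and out-degree$(u)=0$; $Idx[u]=m+1$ if $u=n$ and out-degree$(u)=0$. Convention: $Idx[n+1]=m+1$. **PageRank (iterative method).** Let $od(i)$ be the out-degree of $i$, $s$ the redistribution parameter and $l$ the number of iterations. The update matrix $N=[N_{ij}]$ is the $n\times n$ matrix with $N_{ij}=s/od(i)+(1-s)/n$ if $(i,j)\in E$ and $N_{ij}=(1-s)/n$ otherwise. Starting from $r_i^{(0)}=1/n$ for all $i$, the PageRank value of node $i$ after $k$ iterations is $r_i^{(k)}=\sum_{j=1}^n N_{ji}\,r_j^{(k-1)}$. **Cost model.** Efficiency is measured by the number of primitive operations; addition, subtraction, multiplication, division, comparison and equality check on integers and rationals are primitive operations. The arrays $\overset{\sim}{N},\mathcal{E},Idx,\overset{\sim}{r}^{(0)},\overset{\sim}{r}^{(1)}$ are stored in an Oblivious RAM (ORAM), which allows array accesses at secret indices; $f(n)$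 denotes the number of primitive operations employed for reading/writing an element in an ORAM array of size $n$. The if-else construct is executed by running both branches one after the other, one of them in a dummy fashion. **The PageRank protocol.** Input: $(\mathcal{E},Idx)$, $l$, $s$. Output: the PageRank values of all vertices of $G$. 1. For $i=1$ to $n$, for $j=1$ to $n$: if $Idx[i]==Idx[i+1]$ then $\overset{\sim}{N}[i][j]\leftarrow(1-s)/n$; else $\overset{\sim}{N}[i][j]\leftarrow s/(Idx[i+1]-Idx[i])+(1-s)/n$. 2. $\overset{\sim}{r}^{(0)}[i]\leftarrow 1/n$ and $\overset{\sim}{r}^{(1)}[i]\leftarrow 0$ for $1\le i\le n$. $j\leftarrow 1$. 3. For $k=1$ to $l$: - $v\leftarrow 1$. - For $i=1$ to $m$: { if $i==Idx[v+1]$ then $v\leftarrow v+1$; then, in every case, $\overset{\sim}{r}^{(j)}[\mathcal{E}[i]]\leftarrow\overset{\sim}{r}^{(j)}[\mathcal{E}[i]]+\overset{\sim}{N}[v][\mathcal{E}[i]]*\overset{\sim}{r}^{(1-j)}[v]$ }. - $j\leftarrow 1-j$; then $\overset{\sim}{r}^{(j)}[i]\leftarrow 0$ for $1\le i\le n$.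
   Formalization: Assumes n ≤ Km or l ≤ Kn for a fixed K (resetting ranks costs ln writes; m=1, l=n², f=1 breaks the bound), m < n² (only the complete digraph with all loops is excluded; its edge array has n²+1 cells), and f nondecreasing with f ≥ 1. *)

theory Defs
  imports Complex_Main "HOL-Library.State_Monad" "HOL-Library.Landau_Symbols"
begin

(* Vertices are 1, ..., n. Loops (u, u) are allowed. *)

definition digraph :: "nat \<Rightarrow> (nat \<times> nat) set \<Rightarrow> bool" where
  "digraph n E \<longleftrightarrow> n \<ge> 1 \<and> E \<subseteq> {1..n} \<times> {1..n}"

(* Arrays are indexed from 1: cell i of the array xs is xs ! (i - 1).
   The adjacency lists adj u may list the out-neighbours in any order. The empty last cell
   of the edge array is 0, which is not a vertex. The position of the first neighbour of u
   is one more than the total length of the adjacency lists preceding that of u. *)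

definition edgelist_rep ::
  "nat \<Rightarrow> (nat \<times> nat) set \<Rightarrow> nat list \<Rightarrow> nat list \<Rightarrow> bool" where
  "edgelist_rep n E \<E> Idx \<longleftrightarrow>
     (\<exists>adj :: nat \<Rightarrow> nat list.
        (\<forall>u\<in>{1..n}. distinct (adj u) \<and> set (adj u) = E `` {u}) \<and>
        \<E> = concat (map adj [1..<n + 1]) @ [0] \<and>
        length Idx = n \<and>
        (\<forall>u\<in>{1..n}.
           Idx ! (u - 1) =
             (if card (E `` {u}) \<noteq> 0 then length (concat (map adj [1..<u])) + 1
              else if u \<noteq> n then Idx ! u
              else card E + 1)))"

(* The five ORAM arrays and a counter of the primitive operations executed so far.
   Ntab holds the n x n table row by row; rank 0 and rank 1 are the two rank vectors. *)

record machine =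
  Ntab :: "rat list"
  edges :: "nat list"
  idx :: "nat list"
  rank :: "nat \<Rightarrow> rat list"
  ops :: nat

type_synonym 'a prog = "(machine, 'a) state"

abbreviation ret :: "'a \<Rightarrow> 'a prog" where
  "ret \<equiv> State_Monad.return"

definition tick :: "nat \<Rightarrow> unit prog" where
  "tick c = State_Monad.update (\<lambda>\<sigma>. \<sigma>\<lparr>ops := ops \<sigma> + c\<rparr>)"

(* One primitive operation. Only ever applied to +, -, *, / and = on numbers. *)

definition prim :: "('a \<Rightarrow> 'b \<Rightarrow> 'c) \<Rightarrow> 'a \<Rightarrow> 'b \<Rightarrow> 'c prog" where
  "prim opn x y = do { tick 1; ret (opn x y) }"

(* An access to an ORAM array of N cells costs f N. The array is given by its selector and,
   for writing, by its field update. *)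

definition oread :: "(nat \<Rightarrow> nat) \<Rightarrow> (machine \<Rightarrow> 'a list) \<Rightarrow> nat \<Rightarrow> 'a prog" where
  "oread f A i = do {
     \<sigma> \<leftarrow> State_Monad.get;
     tick (f (length (A \<sigma>)));
     ret (A \<sigma> ! (i - 1)) }"

definition owrite ::
  "(nat \<Rightarrow> nat) \<Rightarrow> (machine \<Rightarrow> 'a list) \<Rightarrow> (('a list \<Rightarrow> 'a list) \<Rightarrow> machine \<Rightarrow> machine)
     \<Rightarrow> nat \<Rightarrow> 'a \<Rightarrow> unit prog" where
  "owrite f A A_update i x = do {
     \<sigma> \<leftarrow> State_Monad.get;
     tick (f (length (A \<sigma>)));
     State_Monad.update (A_update (\<lambda>xs. xs[i - 1 := x])) }"

definition read_rank :: "(nat \<Rightarrow> nat) \<Rightarrow> nat \<Rightarrow> nat \<Rightarrow> rat prog" where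
  "read_rank f j i = oread f (\<lambda>\<sigma>. rank \<sigma> j) i"

definition write_rank :: "(nat \<Rightarrow> nat) \<Rightarrow> nat \<Rightarrow> nat \<Rightarrow> rat \<Rightarrow> unit prog" where
  "write_rank f j i x =
     owrite f (\<lambda>\<sigma>. rank \<sigma> j) (\<lambda>g. rank_update (\<lambda>r. r(j := g (r j)))) i x"

(* The address in Ntab of the entry in row i and column j. *)

definition Ntab_addr :: "nat \<Rightarrow> nat \<Rightarrow> nat \<Rightarrow> nat prog" where
  "Ntab_addr n i j = do {
     a \<leftarrow> prim (-) i 1;
     b \<leftarrow> prim (*) a n;
     prim (+) b j }"

definition read_N :: "(nat \<Rightarrow> nat) \<Rightarrow> nat \<Rightarrow> nat \<Rightarrow> nat \<Rightarrow> rat prog" where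
  "read_N f n i j = do { a \<leftarrow> Ntab_addr n i j; oread f Ntab a }"

definition write_N :: "(nat \<Rightarrow> nat) \<Rightarrow> nat \<Rightarrow> nat \<Rightarrow> nat \<Rightarrow> rat \<Rightarrow> unit prog" where
  "write_N f n i j x = do { a \<leftarrow> Ntab_addr n i j; owrite f Ntab Ntab_update a x }"

(* "For i = 1 to k", with a value carried from one round to the next. Each round is charged
   two further operations, for incrementing the loop counter and comparing it to its bound. *)

primrec for_upto :: "nat \<Rightarrow> (nat \<Rightarrow> 'a \<Rightarrow> 'a prog) \<Rightarrow> 'a \<Rightarrow> 'a prog" where
  "for_upto 0 body a = ret a"
| "for_upto (Suc k) body a = do {
     b \<leftarrow> for_upto k body a;
     tick 2;
     body (Suc k) b }"

(* Both branches are run and paid for. The branch not selected is the dummy run: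
   only its operation count survives. *)

definition oblivious_if :: "bool \<Rightarrow> 'a prog \<Rightarrow> 'a prog \<Rightarrow> 'a prog" where
  "oblivious_if b p q = State (\<lambda>\<sigma>.
     case run_state p \<sigma> of (x, \<sigma>1) \<Rightarrow>
     case run_state q (\<sigma>\<lparr>ops := ops \<sigma>1\<rparr>) of (y, \<sigma>2) \<Rightarrow>
       if b then (x, \<sigma>1\<lparr>ops := ops \<sigma>2\<rparr>) else (y, \<sigma>2))"

definition fill_N :: "(nat \<Rightarrow> nat) \<Rightarrow> nat \<Rightarrow> rat \<Rightarrow> unit prog" where
  "fill_N f n s =
     for_upto n (\<lambda>i _. for_upto n (\<lambda>j _. do {
       p \<leftarrow> oread f idx i;
       i' \<leftarrow> prim (+) i 1;
       q \<leftarrow> oread f idx i';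
       b \<leftarrow> prim (=) p q;
       oblivious_if b
         (do {
            t \<leftarrow> prim (-) 1 s;
            t \<leftarrow> prim (/) t (of_nat n);
            write_N f n i j t })
         (do {
            i' \<leftarrow> prim (+) i 1;
            q \<leftarrow> oread f idx i';
            p \<leftarrow> oread f idx i;
            d \<leftarrow> prim (-) q p;
            w \<leftarrow> prim (/) s (of_nat d);
            t \<leftarrow> prim (-) 1 s;
            t \<leftarrow> prim (/) t (of_nat n);
            w \<leftarrow> prim (+) w t;
            write_N f n i j w }) }) ()) ()"

definition init_ranks :: "(nat \<Rightarrow> nat) \<Rightarrow> nat \<Rightarrow> unit prog" where
  "init_ranks f n =
     for_upto n (\<lambda>i _. do {
       t \<leftarrow> prim (/) 1 (of_nat n);
       write_rank f 0 i t;
       write_rank f 1 i 0 }) ()"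

(* The value carried by the loop is v. *)

definition sweep_edges :: "(nat \<Rightarrow> nat) \<Rightarrow> nat \<Rightarrow> nat \<Rightarrow> nat \<Rightarrow> nat prog" where
  "sweep_edges f n m j =
     for_upto m (\<lambda>i v. do {
       v' \<leftarrow> prim (+) v 1;
       q \<leftarrow> oread f idx v';
       b \<leftarrow> prim (=) i q;
       v \<leftarrow> oblivious_if b (prim (+) v 1) (ret v);
       e \<leftarrow> oread f edges i;
       x \<leftarrow> read_rank f j e;
       e \<leftarrow> oread f edges i;
       w \<leftarrow> read_N f n v e;
       j' \<leftarrow> prim (-) 1 j;
       y \<leftarrow> read_rank f j' v;
       z \<leftarrow> prim (*) w y;
       x \<leftarrow> prim (+) x z;
       e \<leftarrow> oread f edges i;
       write_rank f j e x;
       ret v }) 1"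

definition reset_rank :: "(nat \<Rightarrow> nat) \<Rightarrow> nat \<Rightarrow> nat \<Rightarrow> unit prog" where
  "reset_rank f n j = for_upto n (\<lambda>i _. write_rank f j i 0) ()"

(* After the last round rank j has just been reset, so the result is in the other vector. *)

definition pagerank_protocol ::
  "(nat \<Rightarrow> nat) \<Rightarrow> nat \<Rightarrow> nat \<Rightarrow> nat \<Rightarrow> rat \<Rightarrow> rat list prog" where
  "pagerank_protocol f n m l s = do {
     fill_N f n s;
     init_ranks f n;
     j \<leftarrow> for_upto l (\<lambda>k j. do {
            sweep_edges f n m j;
            j \<leftarrow> prim (-) 1 j;
            reset_rank f n j;
            ret j }) 1;
     \<sigma> \<leftarrow> State_Monad.get;
     ret (rank \<sigma> (1 - j)) }"

(* The numbers n and m are public and can be read off the lengths of the input arrays.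
   The additional last cell of idx holds the conventional value Idx[n+1] = m + 1. *)

definition initial_machine :: "nat list \<Rightarrow> nat list \<Rightarrow> machine" where
  "initial_machine \<E> Idx =
     \<lparr>Ntab = replicate ((length Idx)\<^sup>2) 0,
      edges = \<E>,
      idx = Idx @ [length \<E>],
      rank = (\<lambda>_. replicate (length Idx) 0),
      ops = 0\<rparr>"

definition run_pagerank ::
  "(nat \<Rightarrow> nat) \<Rightarrow> nat list \<Rightarrow> nat list \<Rightarrow> nat \<Rightarrow> rat \<Rightarrow> rat list \<times> machine" where
  "run_pagerank f \<E> Idx l s =
     run_state (pagerank_protocol f (length Idx) (length \<E> - 1) l s) (initial_machine \<E> Idx)"

definition pagerank_ops ::
  "(nat \<Rightarrow> nat) \<Rightarrow> nat list \<Rightarrow> nat list \<Rightarrow> nat \<Rightarrow> rat \<Rightarrow> nat" where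
  "pagerank_ops f \<E> Idx l s = ops (snd (run_pagerank f \<E> Idx l s))"

end

theory Submission
  imports Defs
begin

text \<open>No access ever changes the length of an array, so a single number \<open>F\<close> bounds the cost of all
  accesses, and costs add up along the program, independently of the values it computes.
  For \<open>n \<ge> 2\<close> all arrays have at most \<open>n\<^sup>2\<close> cells (for the edge array this is where
  \<open>card E < n\<^sup>2\<close> enters). For \<open>n = 1\<close> the index array has \<open>n + 1 = 2 > n\<^sup>2\<close> cells, so we take
  \<open>F = f 2 * f (n\<^sup>2)\<close>, the factor \<open>f 2\<close> being a constant. Resetting a rank vector in each round costs
  \<open>l * n\<close> accesses in total, and \<open>l * n \<le> K * (n\<^sup>2 + l * m)\<close> by the last assumption on the inputs.\<close>

text \<open>The bound is on \<open>f\<close> at the lengths, not on the lengths, so preserving it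
  along a program needs no monotonicity of \<open>f\<close>.\<close>

definition accesses_within :: "(nat \<Rightarrow> nat) \<Rightarrow> nat \<Rightarrow> machine \<Rightarrow> bool" where
  "accesses_within f F \<sigma> \<longleftrightarrow>
     f (length (Ntab \<sigma>)) \<le> F \<and> f (length (edges \<sigma>)) \<le> F \<and> f (length (idx \<sigma>)) \<le> F \<and>
     (\<forall>j. f (length (rank \<sigma> j)) \<le> F)"

text \<open>A Hoare triple with \<open>accesses_within\<close> as invariant; preservation is
  included so that bounds can be chained.\<close>

definition costs :: "(nat \<Rightarrow> nat) \<Rightarrow> nat \<Rightarrow> nat \<Rightarrow> 'a prog \<Rightarrow> bool" where
  "costs f F c p \<longleftrightarrow>
     (\<forall>\<sigma>. accesses_within f F \<sigma> \<longrightarrow>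
        accesses_within f F (snd (run_state p \<sigma>)) \<and> ops (snd (run_state p \<sigma>)) \<le> ops \<sigma> + c)"

lemma accesses_within_ops [simp]:
  "accesses_within f F (\<sigma>\<lparr>ops := c\<rparr>) = accesses_within f F \<sigma>"
  by (simp add: accesses_within_def)

lemma costsD:
  assumes "costs f F c p" "accesses_within f F \<sigma>" "run_state p \<sigma> = (x, \<tau>)"
  shows "accesses_within f F \<tau>" "ops \<tau> \<le> ops \<sigma> + c"
  using assms by (force simp: costs_def)+

lemma costs_mono: "costs f F c p \<Longrightarrow> c \<le> d \<Longrightarrow> costs f F d p"
  unfolding costs_def by (meson add_left_mono order_trans)

section \<open>Cost rules for the program constructs\<close>

lemma costs_return: "costs f F 0 (ret x)"
  by (simp add: costs_def State_Monad.return_def)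

lemma costs_get: "costs f F 0 State_Monad.get"
  by (simp add: costs_def State_Monad.get_def)

lemma costs_tick: "costs f F c (tick c)"
  by (simp add: costs_def tick_def State_Monad.update_def State_Monad.get_def State_Monad.set_def
      State_Monad.bind_def)

text \<open>The bound \<open>d\<close> is the same for every result \<open>x\<close>, so the total
  does not depend on computed values.\<close>

lemma costs_bind:
  assumes p: "costs f F c p" and g: "\<And>x. costs f F d (g x)"
  shows "costs f F (c + d) (State_Monad.bind p g)"
  unfolding costs_def
proof (intro allI impI)
  fix \<sigma> assume \<sigma>: "accesses_within f F \<sigma>"
  obtain x \<tau> where 1: "run_state p \<sigma> = (x, \<tau>)" by force
  obtain y \<rho> where 2: "run_state (g x) \<tau> = (y, \<rho>)" by force
  show "accesses_within f F (snd (run_state (State_Monad.bind p g) \<sigma>)) \<and>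
    ops (snd (run_state (State_Monad.bind p g) \<sigma>)) \<le> ops \<sigma> + (c + d)"
    using costsD[OF p \<sigma> 1] costsD[OF g _ 2] 1 2 by (simp add: State_Monad.bind_def)
qed

lemma costs_prim: "costs f F 1 (prim opn x y)"
  unfolding prim_def by (rule costs_mono[OF costs_bind[OF costs_tick costs_return]]) simp

text \<open>Both branches start from the same arrays, the second with the counter left by the first.
  The invariant ignores \<open>ops\<close>, so both bounds apply and add up for either value of
  \<open>b\<close>.\<close>

lemma costs_oblivious_if:
  assumes p: "costs f F c p" and q: "costs f F d q"
  shows "costs f F (c + d) (oblivious_if b p q)"
  unfolding costs_def
proof (intro allI impI)
  fix \<sigma> assume \<sigma>: "accesses_within f F \<sigma>"
  obtain x \<tau> where 1: "run_state p \<sigma> = (x, \<tau>)" by force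
  obtain y \<rho> where 2: "run_state q (\<sigma>\<lparr>ops := ops \<tau>\<rparr>) = (y, \<rho>)" by force
  show "accesses_within f F (snd (run_state (oblivious_if b p q) \<sigma>)) \<and>
    ops (snd (run_state (oblivious_if b p q) \<sigma>)) \<le> ops \<sigma> + (c + d)"
    using costsD[OF p \<sigma> 1] costsD[OF q _ 2] \<sigma> 1 2 by (simp add: oblivious_if_def)
qed

lemma costs_for_upto:
  assumes "\<And>i a. costs f F c (body i a)"
  shows "costs f F (k * (2 + c)) (for_upto k body a)"
proof (induction k)
  case 0
  show ?case by (simp add: costs_return)
next
  case (Suc k)
  have "costs f F (k * (2 + c) + (2 + c)) (for_upto (Suc k) body a)"
    unfolding for_upto.simps by (intro costs_bind Suc costs_tick assms)
  then show ?case by (simp only: mult_Suc add.commute)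
qed

section \<open>Costs of array accesses\<close>

lemma costs_oread:
  assumes "\<And>\<sigma>. accesses_within f F \<sigma> \<Longrightarrow> f (length (A \<sigma>)) \<le> F"
  shows "costs f F F (oread f A i)"
  using assms
  by (simp add: costs_def oread_def tick_def State_Monad.update_def State_Monad.get_def
      State_Monad.set_def State_Monad.return_def State_Monad.bind_def)

lemma costs_owrite:
  assumes "\<And>\<sigma>. accesses_within f F \<sigma> \<Longrightarrow> f (length (A \<sigma>)) \<le> F"
    and "\<And>\<sigma>. accesses_within f F \<sigma> \<Longrightarrow> accesses_within f F (A_update (\<lambda>xs. xs[i - 1 := x]) \<sigma>)"
    and "\<And>\<sigma>. ops (A_update (\<lambda>xs. xs[i - 1 := x]) \<sigma>) = ops \<sigma>"
  shows "costs f F F (owrite f A A_update i x)"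
  using assms
  by (simp add: costs_def owrite_def tick_def State_Monad.update_def State_Monad.get_def
      State_Monad.set_def State_Monad.return_def State_Monad.bind_def)

lemma costs_oread_edges: "costs f F F (oread f edges i)"
  and costs_oread_idx: "costs f F F (oread f idx i)"
  and costs_read_rank: "costs f F F (read_rank f j i)"
  unfolding read_rank_def by (rule costs_oread, simp add: accesses_within_def)+

lemma costs_write_rank: "costs f F F (write_rank f j i x)"
  unfolding write_rank_def by (rule costs_owrite) (auto simp: accesses_within_def)

text \<open>The sum stays unevaluated because \<open>costs_bind\<close> yields exactly this
  shape.\<close>

lemma costs_Ntab_addr: "costs f F (1 + (1 + 1)) (Ntab_addr n i j)"
  unfolding Ntab_addr_def by (intro costs_bind costs_prim)

lemma costs_read_N: "costs f F (1 + (1 + 1) + F) (read_N f n i j)"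
  unfolding read_N_def
  by (intro costs_bind costs_Ntab_addr costs_oread) (simp add: accesses_within_def)

lemma costs_write_N: "costs f F (1 + (1 + 1) + F) (write_N f n i j x)"
  unfolding write_N_def
  by (intro costs_bind costs_Ntab_addr costs_owrite) (auto simp: accesses_within_def)

lemmas costs_intros = costs_bind costs_return costs_get costs_prim costs_oblivious_if
  costs_for_upto costs_oread_edges costs_oread_idx costs_read_rank costs_write_rank
  costs_read_N costs_write_N

section \<open>Costs of the phases of the protocol\<close>

lemma costs_fill_N:
  assumes "F \<ge> 1"
  shows "costs f F (26 * n\<^sup>2 * F) (fill_N f n s)"
proof -
  have "costs f F (n * (2 + n * (18 + 6 * F))) (fill_N f n s)"
    \<comment> \<open>\<open>costs_mono\<close> leaves the cost schematic; the rules build it up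
      along the program, and \<open>simp\<close> compares it with the closed form.\<close>
    unfolding fill_N_def by (rule costs_mono, (rule costs_intros)+) (simp add: algebra_simps)
  moreover have "n * (2 + n * (18 + 6 * F)) \<le> 26 * n\<^sup>2 * F"
  proof -
    have le: "n \<le> n\<^sup>2 * F" "n\<^sup>2 \<le> n\<^sup>2 * F"
      using mult_mono[of n "n\<^sup>2" 1 F] mult_mono[of "n\<^sup>2" "n\<^sup>2" 1 F] assms
      by (simp_all add: power2_eq_square)
    have "n * (2 + n * (18 + 6 * F)) = 2 * n + 18 * n\<^sup>2 + 6 * (n\<^sup>2 * F)"
      by (simp add: algebra_simps power2_eq_square)
    \<comment> \<open>Each of the three terms is absorbed into \<open>n\<^sup>2 * F\<close>, and 26
      = 2 + 18 + 6.\<close>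
    also have "\<dots> \<le> 26 * (n\<^sup>2 * F)"
      using le by linarith
    finally show ?thesis by (simp only: mult.assoc)
  qed
  ultimately show ?thesis
    by (rule costs_mono)
qed

lemma costs_init_ranks:
  assumes "F \<ge> 1"
  shows "costs f F (5 * n\<^sup>2 * F) (init_ranks f n)"
proof -
  have "costs f F (n * (3 + 2 * F)) (init_ranks f n)"
    unfolding init_ranks_def by (rule costs_mono, (rule costs_intros)+) (simp add: algebra_simps)
  moreover have "n * (3 + 2 * F) \<le> n\<^sup>2 * (5 * F)"
    using assms by (intro mult_mono) (auto simp: power2_eq_square)
  ultimately show ?thesis
    by (elim costs_mono) (simp add: ac_simps)
qed

lemma costs_sweep_edges:
  assumes "F \<ge> 1"
  shows "costs f F (19 * m * F) (sweep_edges f n m j)"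
proof -
  have "costs f F (m * (11 + 8 * F)) (sweep_edges f n m j)"
    unfolding sweep_edges_def by (rule costs_mono, (rule costs_intros)+) (simp add: algebra_simps)
  moreover have "m * (11 + 8 * F) \<le> m * (19 * F)"
    using assms by (intro mult_left_mono) auto
  ultimately show ?thesis
    by (elim costs_mono) (simp add: ac_simps)
qed

lemma costs_reset_rank:
  assumes "F \<ge> 1"
  shows "costs f F (3 * n * F) (reset_rank f n j)"
proof -
  have "costs f F (n * (2 + F)) (reset_rank f n j)"
    unfolding reset_rank_def by (rule costs_mono, (rule costs_intros)+) (simp add: algebra_simps)
  moreover have "n * (2 + F) \<le> n * (3 * F)"
    using assms by (intro mult_left_mono) auto
  ultimately show ?thesis
    by (elim costs_mono) (simp add: ac_simps)
qed

lemma costs_pagerank_protocol: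
  assumes "F \<ge> 1" "n \<ge> 1"
  shows "costs f F ((31 * n\<^sup>2 + 19 * (l * m) + 6 * (l * n)) * F) (pagerank_protocol f n m l s)"
proof -
  have "costs f F (26 * n\<^sup>2 * F + (5 * n\<^sup>2 * F + l * (3 + 19 * m * F + 3 * n * F)))
          (pagerank_protocol f n m l s)"
    unfolding pagerank_protocol_def
    by (rule costs_mono, (rule costs_fill_N[OF assms(1)] costs_init_ranks[OF assms(1)]
          costs_sweep_edges[OF assms(1)] costs_reset_rank[OF assms(1)] costs_intros)+) (simp add: algebra_simps)
  \<comment> \<open>Each round has 3 operations outside the sweep and the reset: 2 for the loop and
    1 for flipping \<open>j\<close>. Absorbing them into \<open>n * F\<close> raises the coefficient
    of \<open>l * n\<close> from 3 to 6.\<close>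
  moreover have "l * 1 \<le> l * (n * F)"
    using assms by (intro mult_left_mono) auto
  ultimately show ?thesis
    by (elim costs_mono) (simp add: algebra_simps)
qed

section \<open>Lengths of the input arrays\<close>

lemma length_edgelist_rep:
  assumes "digraph n E" "edgelist_rep n E \<E> Idx"
  shows "length \<E> = card E + 1" "length Idx = n"
proof -
  obtain adj where adj: "\<forall>u\<in>{1..n}. distinct (adj u) \<and> set (adj u) = E `` {u}"
    and \<E>: "\<E> = concat (map adj [1..<n + 1]) @ [0]" and "length Idx = n"
    using assms(2) unfolding edgelist_rep_def by blast
  then show "length Idx = n" by simp
  have sub: "E \<subseteq> {1..n} \<times> {1..n}"
    using assms(1) by (simp add: digraph_def)
  \<comment> \<open>As a disjoint union of out-neighbourhoods, \<open>E\<close> has as many elements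
    as the adjacency lists have entries, since these are distinct.\<close>
  have E: "E = (SIGMA u:{1..n}. E `` {u})"
    using sub by auto
  have "length (concat (map adj [1..<n + 1])) = (\<Sum>u = 1..n. length (adj u))"
    by (simp add: length_concat comp_def sum_list_distinct_conv_sum_set
        atLeastLessThanSuc_atLeastAtMost del: upt_Suc)
  also have "\<dots> = (\<Sum>u = 1..n. card (E `` {u}))"
    using adj by (intro sum.cong refl) (metis distinct_card)
  also have "\<dots> = card (SIGMA u:{1..n}. E `` {u})"
  proof (intro card_SigmaI[symmetric] ballI)
    show "finite (E `` {u})" for u
      by (rule finite_subset[of _ "{1..n}"]) (use sub in auto)
  qed simp
  also have "\<dots> = card E"
    by (rule arg_cong[OF E[symmetric]])
  finally show "length \<E> = card E + 1"
    by (simp add: \<E>)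
qed

lemma accesses_within_initial_machine:
  fixes f :: "nat \<Rightarrow> nat"
  assumes f: "mono f" "\<And>k. k \<ge> 1 \<Longrightarrow> f k \<ge> 1"
    and n: "length Idx = n" "n \<ge> 1" and m: "length \<E> \<le> n\<^sup>2"
  shows "accesses_within f (f 2 * f (n\<^sup>2)) (initial_machine \<E> Idx)"
proof -
  \<comment> \<open>With both factors at least 1, the product dominates each of them.\<close>
  have f2: "f 2 \<ge> 1" and fn: "f (n\<^sup>2) \<ge> 1"
    using f(2) n by auto
  have le: "f k \<le> f 2 * f (n\<^sup>2)" if "k \<le> n\<^sup>2" for k
    using mult_le_mono[OF f2 monoD[OF f(1) that]] by simp
  have "f (Suc n) \<le> f 2 * f (n\<^sup>2)"
  proof (cases "n = 1")
    case True
    then show ?thesis using fn by (simp add: numeral_2_eq_2)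
  next
    case False
    then have "n * 2 \<le> n * n" using n by (intro mult_left_mono) auto
    then have "Suc n \<le> n\<^sup>2" using n(2) unfolding power2_eq_square by linarith
    then show ?thesis by (rule le)
  qed
  moreover have "n \<le> n\<^sup>2"
    by (simp add: power2_eq_square)
  ultimately show ?thesis
    using le m n by (simp add: accesses_within_def initial_machine_def)
qed

section \<open>The bound for a single input\<close>

lemma pagerank_ops_le:
  fixes f :: "nat \<Rightarrow> nat"
  assumes f: "mono f" "\<And>k. k \<ge> 1 \<Longrightarrow> f k \<ge> 1"
    and E: "digraph n E" "card E < n\<^sup>2" "edgelist_rep n E \<E> Idx"
    and K: "n \<le> K * card E \<or> l \<le> K * n"
  shows "pagerank_ops f \<E> Idx l s \<le> (31 + 6 * K) * f 2 * ((n\<^sup>2 + l * card E) * f (n\<^sup>2))"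
proof -
  let ?F = "f 2 * f (n\<^sup>2)" and ?m = "card E"
  have n: "n \<ge> 1" using E(1) by (simp add: digraph_def)
  note len = length_edgelist_rep[OF E(1,3)]
  have "?F \<ge> 1" using f(2)[of 2] f(2)[of "n\<^sup>2"] n by simp
  note cost = costs_pagerank_protocol[OF this n, of f l ?m s]
  have "accesses_within f ?F (initial_machine \<E> Idx)"
    using f len n E(2) by (intro accesses_within_initial_machine) auto
  then have "pagerank_ops f \<E> Idx l s \<le> (31 * n\<^sup>2 + 19 * (l * ?m) + 6 * (l * n)) * ?F"
    using cost len by (auto simp: costs_def pagerank_ops_def run_pagerank_def initial_machine_def)
  also have "\<dots> \<le> (31 + 6 * K) * (n\<^sup>2 + l * ?m) * ?F"
  proof (rule mult_right_mono)
    \<comment> \<open>The first alternative for \<open>K\<close> bounds \<open>l * n\<close> by the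
      \<open>l * ?m\<close> part, the second by the \<open>n\<^sup>2\<close> part. The term
      \<open>6 * (l * n)\<close> thus contributes \<open>6 * K\<close> to the constant.\<close>
    have "l * n \<le> K * (n\<^sup>2 + l * ?m)"
      using K
    proof
      assume "n \<le> K * ?m"
      then have "l * n \<le> l * (K * ?m)" by (rule mult_left_mono) simp
      also have "\<dots> \<le> K * (n\<^sup>2 + l * ?m)" by (simp add: algebra_simps power2_eq_square)
      finally show ?thesis .
    next
      assume "l \<le> K * n"
      then have "l * n \<le> K * n * n" by (rule mult_right_mono) simp
      also have "\<dots> \<le> K * (n\<^sup>2 + l * ?m)" by (simp add: algebra_simps power2_eq_square)
      finally show ?thesis .
    qed
    then show "31 * n\<^sup>2 + 19 * (l * ?m) + 6 * (l * n) \<le> (31 + 6 * K) * (n\<^sup>2 + l * ?m)"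
      by (simp add: algebra_simps)
  qed simp
  finally show ?thesis by (simp add: ac_simps)
qed

theorem theorem6:
  fixes f :: "nat \<Rightarrow> nat" and K :: nat
  assumes "mono f" and "\<And>k. k \<ge> 1 \<Longrightarrow> f k \<ge> 1"
  shows "(\<lambda>(n, E, \<E>, Idx, l, s). real (pagerank_ops f \<E> Idx l s))
           \<in> O[principal {(n, E, \<E>, Idx, l, s).
                digraph n E \<and> card E < n\<^sup>2 \<and> edgelist_rep n E \<E> Idx \<and>
                (n \<le> K * card E \<or> l \<le> K * n)}](\<lambda>(n, E, \<E>, Idx, l, s). real ((n\<^sup>2 + l * card E) * f (n\<^sup>2)))"
proof (rule landau_o.bigI[of "real ((31 + 6 * K) * f 2)"])
  show "0 < real ((31 + 6 * K) * f 2)"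
    using assms(2)[of 2] by simp
  have "real (pagerank_ops f \<E> Idx l s)
      \<le> real ((31 + 6 * K) * f 2) * real ((n\<^sup>2 + l * card E) * f (n\<^sup>2))"
    if "digraph n E" "card E < n\<^sup>2" "edgelist_rep n E \<E> Idx" "n \<le> K * card E \<or> l \<le> K * n"
    for n E \<E> Idx l s
    using pagerank_ops_le[OF assms that, of s] unfolding of_nat_mult[symmetric] of_nat_le_iff .
  \<comment> \<open>On a principal filter, "eventually" means everywhere on the set. The constant
    depends only on \<open>f\<close> and \<open>K\<close>, so it serves all inputs at once.\<close>
  then show "\<forall>\<^sub>F x in principal {(n, E, \<E>, Idx, l, s).
        digraph n E \<and> card E < n\<^sup>2 \<and> edgelist_rep n E \<E> Idx \<and> (n \<le> K * card E \<or> l \<le> K * n)}.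
      norm (case x of (n, E, \<E>, Idx, l, s) \<Rightarrow> real (pagerank_ops f \<E> Idx l s))
      \<le> real ((31 + 6 * K) * f 2) *
         norm (case x of (n, E, \<E>, Idx, l, s) \<Rightarrow> real ((n\<^sup>2 + l * card E) * f (n\<^sup>2)))"
    unfolding eventually_principal by (auto simp del: of_nat_mult)
qed

end
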